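(* Let $R$ be an integral domain and $p,q\in R$. The matrix $\begin{pmatrix} p & q\\ 0 & 0\end{pmatrix}$ is a product of idempotent $2\times 2$ matrices over $R$ if and only if $\begin{pmatrix} q & p\\ 0 & 0\end{pmatrix}$ is a product of idempotent $2\times 2$ matrices over $R$.
   Context: A matrix $E$ over $R$ is idempotent if $E^2=E$. "Product of idempotent matrices" means a finite product of idempotent $2\times2$ matrices with entries in $R$. *)

theory Defs
  imports "HOL-Analysis.Analysis"
begin

definition idempotent_mat :: "'a::comm_ring_1 ^ 2 ^ 2 \<Rightarrow> bool" where
  "idempotent_mat E \<longleftrightarrow> E ** E = E"

text \<open>A finite product of idempotent 2x2 matrices over the ring.\<close>
definition prod_idempotents :: "'a::comm_ring_1 ^ 2 ^ 2 \<Rightarrow> bool" where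
  "prod_idempotents A \<longleftrightarrow>
     (\<exists>Es :: ('a ^ 2 ^ 2) list. (\<forall>E \<in> set Es. idempotent_mat E) \<and>
        A = foldr (**) Es (mat 1))"

definition mat2 :: "'a::zero \<Rightarrow> 'a \<Rightarrow> 'a \<Rightarrow> 'a \<Rightarrow> 'a ^ 2 ^ 2" where
  "mat2 a b c d = (\<chi> i j. if i = 1 then (if j = 1 then a else b)
                              else (if j = 1 then c else d))"

end

theory Submission
  imports Defs
begin

text \<open>Conjugating by the permutation matrix that swaps the two coordinates turns
  \<open>mat2 p q 0 0\<close> into \<open>mat2 0 0 q p\<close>; multiplying on the left by the idempotent
  \<open>mat2 1 1 0 0\<close> then gives \<open>mat2 q p 0 0\<close>. Since conjugation preserves idempotency
  and products, both steps stay within products of idempotents. The argument works over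
  any commutative ring.\<close>

lemma idempotent_mat_conj:
  fixes P Q E :: "'a::comm_ring_1 ^ 2 ^ 2"
  assumes "Q ** P = mat 1" and "idempotent_mat E"
  shows "idempotent_mat (P ** E ** Q)"
proof -
  have "(P ** E ** Q) ** (P ** E ** Q) = P ** E ** (Q ** P) ** E ** Q"
    by (simp add: matrix_mul_assoc)
  also have "\<dots> = P ** (E ** E) ** Q"
    using assms(1) by (simp add: matrix_mul_assoc)
  finally show ?thesis
    using assms(2) by (simp add: idempotent_mat_def)
qed

lemma foldr_matrix_mult_conj:
  fixes P Q :: "'a::comm_ring_1 ^ 'n ^ 'n"
  assumes "P ** Q = mat 1" and "Q ** P = mat 1"
  shows "foldr (**) (map (\<lambda>E. P ** E ** Q) Es) (mat 1) = P ** foldr (**) Es (mat 1) ** Q"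
proof (induction Es)
  case Nil
  then show ?case using assms(1) by simp
next
  case (Cons E Es)
  have "foldr (**) (map (\<lambda>E. P ** E ** Q) (E # Es)) (mat 1)
      = P ** E ** (Q ** P) ** foldr (**) Es (mat 1) ** Q"
    using Cons by (simp add: matrix_mul_assoc)
  also have "\<dots> = P ** foldr (**) (E # Es) (mat 1) ** Q"
    using assms(2) by (simp add: matrix_mul_assoc)
  finally show ?case .
qed

lemma prod_idempotents_conj:
  fixes P Q A :: "'a::comm_ring_1 ^ 2 ^ 2"
  assumes "P ** Q = mat 1" and "Q ** P = mat 1" and "prod_idempotents A"
  shows "prod_idempotents (P ** A ** Q)"
proof -
  obtain Es where "\<forall>E\<in>set Es. idempotent_mat E" and "A = foldr (**) Es (mat 1)"
    using assms(3) unfolding prod_idempotents_def by blast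
  then have "\<forall>E\<in>set (map (\<lambda>E. P ** E ** Q) Es). idempotent_mat E"
    and "P ** A ** Q = foldr (**) (map (\<lambda>E. P ** E ** Q) Es) (mat 1)"
    using idempotent_mat_conj[OF assms(2)] foldr_matrix_mult_conj[OF assms(1,2)] by auto
  then show ?thesis
    unfolding prod_idempotents_def by blast
qed

lemma prod_idempotents_mult_idempotent:
  fixes E A :: "'a::comm_ring_1 ^ 2 ^ 2"
  assumes "idempotent_mat E" and "prod_idempotents A"
  shows "prod_idempotents (E ** A)"
proof -
  obtain Es where "\<forall>E\<in>set Es. idempotent_mat E" and "A = foldr (**) Es (mat 1)"
    using assms(2) unfolding prod_idempotents_def by blast
  then have "\<forall>F\<in>set (E # Es). idempotent_mat F" and "E ** A = foldr (**) (E # Es) (mat 1)"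
    using assms(1) by auto
  then show ?thesis
    unfolding prod_idempotents_def by blast
qed

lemma mat2_swap_squared: "mat2 0 1 1 0 ** mat2 0 1 1 0 = (mat 1 :: 'a::comm_ring_1 ^ 2 ^ 2)"
  by (simp add: mat2_def vec_eq_iff matrix_matrix_mult_def sum_2 forall_2 mat_def)

lemma idempotent_mat_row_ones: "idempotent_mat (mat2 1 1 0 0 :: 'a::comm_ring_1 ^ 2 ^ 2)"
  by (simp add: idempotent_mat_def mat2_def vec_eq_iff matrix_matrix_mult_def sum_2 forall_2)

lemma mat2_row_ones_mult_swap_conj:
  fixes p q :: "'a::comm_ring_1"
  shows "mat2 1 1 0 0 ** (mat2 0 1 1 0 ** mat2 p q 0 0 ** mat2 0 1 1 0) = mat2 q p 0 0"
  by (simp add: mat2_def vec_eq_iff matrix_matrix_mult_def sum_2 forall_2)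

lemma prod_idempotents_row_swap:
  fixes p q :: "'a::comm_ring_1"
  assumes "prod_idempotents (mat2 p q 0 0)"
  shows "prod_idempotents (mat2 q p 0 0)"
  using prod_idempotents_mult_idempotent[OF idempotent_mat_row_ones
      prod_idempotents_conj[OF mat2_swap_squared mat2_swap_squared assms]]
  by (simp only: mat2_row_ones_mult_swap_conj)

theorem lemma3p1:
  fixes p q :: "'a::idom"
  shows "prod_idempotents (mat2 p q 0 0) \<longleftrightarrow> prod_idempotents (mat2 q p 0 0)"
  using prod_idempotents_row_swap by blast

end
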